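(* Let $R$ and $S$ be unital $2$-torsion free rings, let $M$ be a unital $2$-torsion free $(R,S)$-bimodule which is faithful as a left $R$-module and faithful as a right $S$-module, and let $T=\mathrm{Tri}(R,M,S)$ be the associated triangular ring. If $\varphi:T\to T$ is a Jordan centralizer, then $\varphi$ is a centralizer.
   Context: All rings are associative. The triangular ring $\mathrm{Tri}(R,M,S)$ is the ring of all matrices $\begin{pmatrix} r & m\\ 0 & s\end{pmatrix}$ with $r\in R$, $m\in M$, $s\in S$, under the usual matrix operations. A ring or module is $2$-torsion free if $2x=0$ implies $x=0$. An additive map $\varphi$ on a ring $A$ is a centralizer if $\varphi(xy)=x\varphi(y)=\varphi(x)y$ for all $x,y\in A$, and a Jordan centralizer if $\varphi(xy+yx)=x\varphi(y)+\varphi(y)x$ for all $x,y\in A$. *)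

theory Defs
  imports "HOL-Algebra.Module"
begin

(* HOL-Algebra's locale ring is that of unital associative rings (1 = 0 is permitted).
   Its locale module is restricted to commutative coefficient rings, so bimodules are
   introduced here: the record reuses the left action smult and adds a right action.
   As for HOL-Algebra modules, the inherited fields mult and one of M carry no meaning. *)

record ('a, 'b, 'c) bimodule = "('a, 'b) module" +
  rsmult :: "['b, 'c] \<Rightarrow> 'b" (infixl \<open>\<triangleleft>\<index>\<close> 70)

locale bimodule = R: ring R + S: ring S + M: abelian_group M
  for R :: "('a, 'd) ring_scheme"
  and M :: "('a, 'b, 'c, 'e) bimodule_scheme"
  and S :: "('c, 'f) ring_scheme" +
  assumes smult_closed:
      "\<lbrakk>r \<in> carrier R; m \<in> carrier M\<rbrakk> \<Longrightarrow> r \<odot>\<^bsub>M\<^esub> m \<in> carrier M"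
    and smult_l_distr:
      "\<lbrakk>r \<in> carrier R; r' \<in> carrier R; m \<in> carrier M\<rbrakk> \<Longrightarrow>
        (r \<oplus>\<^bsub>R\<^esub> r') \<odot>\<^bsub>M\<^esub> m = (r \<odot>\<^bsub>M\<^esub> m) \<oplus>\<^bsub>M\<^esub> (r' \<odot>\<^bsub>M\<^esub> m)"
    and smult_r_distr:
      "\<lbrakk>r \<in> carrier R; m \<in> carrier M; n \<in> carrier M\<rbrakk> \<Longrightarrow>
        r \<odot>\<^bsub>M\<^esub> (m \<oplus>\<^bsub>M\<^esub> n) = (r \<odot>\<^bsub>M\<^esub> m) \<oplus>\<^bsub>M\<^esub> (r \<odot>\<^bsub>M\<^esub> n)"
    and smult_assoc:
      "\<lbrakk>r \<in> carrier R; r' \<in> carrier R; m \<in> carrier M\<rbrakk> \<Longrightarrow>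
        (r \<otimes>\<^bsub>R\<^esub> r') \<odot>\<^bsub>M\<^esub> m = r \<odot>\<^bsub>M\<^esub> (r' \<odot>\<^bsub>M\<^esub> m)"
    and smult_one:
      "m \<in> carrier M \<Longrightarrow> \<one>\<^bsub>R\<^esub> \<odot>\<^bsub>M\<^esub> m = m"
    and rsmult_closed:
      "\<lbrakk>m \<in> carrier M; s \<in> carrier S\<rbrakk> \<Longrightarrow> m \<triangleleft>\<^bsub>M\<^esub> s \<in> carrier M"
    and rsmult_r_distr:
      "\<lbrakk>m \<in> carrier M; s \<in> carrier S; s' \<in> carrier S\<rbrakk> \<Longrightarrow>
        m \<triangleleft>\<^bsub>M\<^esub> (s \<oplus>\<^bsub>S\<^esub> s') = (m \<triangleleft>\<^bsub>M\<^esub> s) \<oplus>\<^bsub>M\<^esub> (m \<triangleleft>\<^bsub>M\<^esub> s')"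
    and rsmult_l_distr:
      "\<lbrakk>m \<in> carrier M; n \<in> carrier M; s \<in> carrier S\<rbrakk> \<Longrightarrow>
        (m \<oplus>\<^bsub>M\<^esub> n) \<triangleleft>\<^bsub>M\<^esub> s = (m \<triangleleft>\<^bsub>M\<^esub> s) \<oplus>\<^bsub>M\<^esub> (n \<triangleleft>\<^bsub>M\<^esub> s)"
    and rsmult_assoc:
      "\<lbrakk>m \<in> carrier M; s \<in> carrier S; s' \<in> carrier S\<rbrakk> \<Longrightarrow>
        m \<triangleleft>\<^bsub>M\<^esub> (s \<otimes>\<^bsub>S\<^esub> s') = (m \<triangleleft>\<^bsub>M\<^esub> s) \<triangleleft>\<^bsub>M\<^esub> s'"
    and rsmult_one:
      "m \<in> carrier M \<Longrightarrow> m \<triangleleft>\<^bsub>M\<^esub> \<one>\<^bsub>S\<^esub> = m"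
    and smult_rsmult_assoc:
      "\<lbrakk>r \<in> carrier R; m \<in> carrier M; s \<in> carrier S\<rbrakk> \<Longrightarrow>
        (r \<odot>\<^bsub>M\<^esub> m) \<triangleleft>\<^bsub>M\<^esub> s = r \<odot>\<^bsub>M\<^esub> (m \<triangleleft>\<^bsub>M\<^esub> s)"

definition faithful_left :: "('a, 'd) ring_scheme \<Rightarrow> ('a, 'b, 'c, 'e) bimodule_scheme \<Rightarrow> bool"
  where "faithful_left R M \<longleftrightarrow>
    (\<forall>r \<in> carrier R. (\<forall>m \<in> carrier M. r \<odot>\<^bsub>M\<^esub> m = \<zero>\<^bsub>M\<^esub>) \<longrightarrow> r = \<zero>\<^bsub>R\<^esub>)"

definition faithful_right :: "('a, 'b, 'c, 'e) bimodule_scheme \<Rightarrow> ('c, 'f) ring_scheme \<Rightarrow> bool"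
  where "faithful_right M S \<longleftrightarrow>
    (\<forall>s \<in> carrier S. (\<forall>m \<in> carrier M. m \<triangleleft>\<^bsub>M\<^esub> s = \<zero>\<^bsub>M\<^esub>) \<longrightarrow> s = \<zero>\<^bsub>S\<^esub>)"

(* Only the additive structure matters, so this serves for rings and for (bi)modules. *)
definition two_torsion_free :: "('a, 'd) ring_scheme \<Rightarrow> bool"
  where "two_torsion_free A \<longleftrightarrow>
    (\<forall>x \<in> carrier A. add_pow A (2::nat) x = \<zero>\<^bsub>A\<^esub> \<longrightarrow> x = \<zero>\<^bsub>A\<^esub>)"

(* The triple (r, m, s) stands for the upper triangular matrix with diagonal entries
   r, s and upper right entry m; mult is then the usual matrix product. *)
definition Tri :: "('a, 'd) ring_scheme \<Rightarrow> ('a, 'b, 'c, 'e) bimodule_scheme \<Rightarrow>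
    ('c, 'f) ring_scheme \<Rightarrow> ('a \<times> 'b \<times> 'c) ring"
  where "Tri R M S =
    \<lparr>carrier = carrier R \<times> carrier M \<times> carrier S,
     mult = (\<lambda>(r, m, s) (r', m', s').
       (r \<otimes>\<^bsub>R\<^esub> r', (r \<odot>\<^bsub>M\<^esub> m') \<oplus>\<^bsub>M\<^esub> (m \<triangleleft>\<^bsub>M\<^esub> s'), s \<otimes>\<^bsub>S\<^esub> s')),
     one = (\<one>\<^bsub>R\<^esub>, \<zero>\<^bsub>M\<^esub>, \<one>\<^bsub>S\<^esub>),
     zero = (\<zero>\<^bsub>R\<^esub>, \<zero>\<^bsub>M\<^esub>, \<zero>\<^bsub>S\<^esub>),
     add = (\<lambda>(r, m, s) (r', m', s').
       (r \<oplus>\<^bsub>R\<^esub> r', m \<oplus>\<^bsub>M\<^esub> m', s \<oplus>\<^bsub>S\<^esub> s'))\<rparr>"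

definition additive_map :: "('a, 'd) ring_scheme \<Rightarrow> ('a \<Rightarrow> 'a) \<Rightarrow> bool"
  where "additive_map A \<phi> \<longleftrightarrow> \<phi> \<in> hom (add_monoid A) (add_monoid A)"

definition centralizer_map :: "('a, 'd) ring_scheme \<Rightarrow> ('a \<Rightarrow> 'a) \<Rightarrow> bool"
  where "centralizer_map A \<phi> \<longleftrightarrow> additive_map A \<phi> \<and>
    (\<forall>x \<in> carrier A. \<forall>y \<in> carrier A.
      \<phi> (x \<otimes>\<^bsub>A\<^esub> y) = x \<otimes>\<^bsub>A\<^esub> \<phi> y \<and> x \<otimes>\<^bsub>A\<^esub> \<phi> y = \<phi> x \<otimes>\<^bsub>A\<^esub> y)"

definition jordan_centralizer_map :: "('a, 'd) ring_scheme \<Rightarrow> ('a \<Rightarrow> 'a) \<Rightarrow> bool"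
  where "jordan_centralizer_map A \<phi> \<longleftrightarrow> additive_map A \<phi> \<and>
    (\<forall>x \<in> carrier A. \<forall>y \<in> carrier A.
      \<phi> ((x \<otimes>\<^bsub>A\<^esub> y) \<oplus>\<^bsub>A\<^esub> (y \<otimes>\<^bsub>A\<^esub> x)) = (x \<otimes>\<^bsub>A\<^esub> \<phi> y) \<oplus>\<^bsub>A\<^esub> (\<phi> y \<otimes>\<^bsub>A\<^esub> x))"

lemma (in bimodule) Tri_is_ring: "ring (Tri R M S)"
proof (rule ringI)
  show "abelian_group (Tri R M S)"
  proof (rule abelian_groupI)
    fix x assume "x \<in> carrier (Tri R M S)"
    then obtain r m s where x: "x = (r, m, s)"
      and in_carrier: "r \<in> carrier R" "m \<in> carrier M" "s \<in> carrier S"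
      by (auto simp: Tri_def)
    then show "\<exists>y \<in> carrier (Tri R M S). y \<oplus>\<^bsub>Tri R M S\<^esub> x = \<zero>\<^bsub>Tri R M S\<^esub>"
      by (intro bexI[of _ "(\<ominus>\<^bsub>R\<^esub> r, \<ominus>\<^bsub>M\<^esub> m, \<ominus>\<^bsub>S\<^esub> s)"])
        (auto simp: Tri_def R.l_neg M.l_neg S.l_neg)
  qed (auto simp: Tri_def R.a_ac M.a_ac S.a_ac)
  have lz: "r \<odot>\<^bsub>M\<^esub> \<zero>\<^bsub>M\<^esub> = \<zero>\<^bsub>M\<^esub>" if "r \<in> carrier R" for r
  proof -
    have "(r \<odot>\<^bsub>M\<^esub> \<zero>\<^bsub>M\<^esub>) \<oplus>\<^bsub>M\<^esub> (r \<odot>\<^bsub>M\<^esub> \<zero>\<^bsub>M\<^esub>) = r \<odot>\<^bsub>M\<^esub> \<zero>\<^bsub>M\<^esub>"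
      using that smult_r_distr[of r "\<zero>\<^bsub>M\<^esub>" "\<zero>\<^bsub>M\<^esub>"] by simp
    then show ?thesis using that smult_closed M.add.l_cancel_one' by simp
  qed
  have rz: "\<zero>\<^bsub>M\<^esub> \<triangleleft>\<^bsub>M\<^esub> s = \<zero>\<^bsub>M\<^esub>" if "s \<in> carrier S" for s
  proof -
    have "(\<zero>\<^bsub>M\<^esub> \<triangleleft>\<^bsub>M\<^esub> s) \<oplus>\<^bsub>M\<^esub> (\<zero>\<^bsub>M\<^esub> \<triangleleft>\<^bsub>M\<^esub> s) = \<zero>\<^bsub>M\<^esub> \<triangleleft>\<^bsub>M\<^esub> s"
      using that rsmult_l_distr[of "\<zero>\<^bsub>M\<^esub>" "\<zero>\<^bsub>M\<^esub>" s] by simp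
    then show ?thesis using that rsmult_closed M.add.l_cancel_one' by simp
  qed
  show "monoid (Tri R M S)"
    by (rule monoidI) (auto simp: Tri_def smult_closed rsmult_closed smult_one rsmult_one lz rz
        R.m_assoc S.m_assoc smult_assoc rsmult_assoc smult_r_distr rsmult_l_distr
        smult_rsmult_assoc M.a_assoc)
qed (auto simp: Tri_def smult_closed rsmult_closed R.l_distr S.l_distr R.r_distr S.r_distr
      smult_l_distr smult_r_distr rsmult_l_distr rsmult_r_distr M.a_ac)

end

theory Submission
  imports Defs
begin

(* Put c = \<phi> 1. Setting y = 1 in the Jordan identity gives 2 \<phi>(x) = x c + c x, and substituting
   this back into twice the Jordan identity shows that every commutator [x, c] is central.
   In a triangular ring this forces c itself to be central: testing with the idempotent
   (1, 0, 0) kills the off-diagonal entry of c, testing with (0, n, 0) gives a n = n b for the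
   diagonal entries a and b of c, and faithfulness then makes a and b central. Hence
   2 \<phi>(x) = 2 c x, and dividing by 2 exhibits \<phi> as multiplication by a central element. *)

section \<open>Division by 2 in abelian groups, and additive maps\<close>

lemma (in abelian_group) minus_zero_imp_eq:
  assumes "x \<in> carrier G" and "y \<in> carrier G" and "x \<ominus> y = \<zero>"
  shows "x = y"
  using assms minus_equality[of x "\<ominus> y"] by (simp add: minus_eq)

text \<open>The double of \<open>x \<ominus> y\<close> is the difference of the doubles. Working in
  an abelian group lets one lemma serve the rings, the bimodule and the triangular ring.\<close>

lemma (in abelian_group) two_torsion_free_cancel:
  assumes "two_torsion_free G" and "x \<in> carrier G" and "y \<in> carrier G"
    and "x \<oplus> x = y \<oplus> y"
  shows "x = y"
proof -
  have "add_pow G (2::nat) (x \<ominus> y) = (x \<ominus> y) \<oplus> (x \<ominus> y)"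
    using assms(2,3) by (simp add: numeral_2_eq_2 add.nat_pow_Suc)
  also have "\<dots> = (x \<oplus> x) \<ominus> (y \<oplus> y)"
    using assms(2,3) by (simp add: minus_eq minus_add a_ac)
  also have "\<dots> = \<zero>"
    using assms(2-4) by (simp add: minus_eq r_neg)
  finally have "x \<ominus> y = \<zero>"
    using assms(1-3) unfolding two_torsion_free_def by simp
  then show ?thesis
    using assms(2,3) by (rule minus_zero_imp_eq[rotated 2])
qed

lemma additive_map_closed:
  "\<lbrakk>additive_map A \<phi>; x \<in> carrier A\<rbrakk> \<Longrightarrow> \<phi> x \<in> carrier A"
  by (auto simp: additive_map_def hom_def)

lemma additive_map_add:
  "\<lbrakk>additive_map A \<phi>; x \<in> carrier A; y \<in> carrier A\<rbrakk> \<Longrightarrow> \<phi> (x \<oplus>\<^bsub>A\<^esub> y) = \<phi> x \<oplus>\<^bsub>A\<^esub> \<phi> y"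
  by (auto simp: additive_map_def hom_def)

section \<open>Jordan centralizers on an arbitrary unital ring\<close>

lemma (in ring) jordan_centralizer_double:
  assumes "jordan_centralizer_map R \<phi>" and "x \<in> carrier R"
  shows "\<phi> x \<oplus> \<phi> x = (x \<otimes> \<phi> \<one>) \<oplus> (\<phi> \<one> \<otimes> x)"
proof -
  have add: "additive_map R \<phi>"
    and "\<phi> ((x \<otimes> \<one>) \<oplus> (\<one> \<otimes> x)) = (x \<otimes> \<phi> \<one>) \<oplus> (\<phi> \<one> \<otimes> x)"
    using assms one_closed unfolding jordan_centralizer_map_def by blast+
  then show ?thesis
    using assms(2) additive_map_add[OF add, of x x] by simp
qed

text \<open>Centrality of the commutators \<open>[x, \<phi> 1]\<close>, rearranged so that no subtraction occurs.\<close>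

lemma (in ring) jordan_centralizer_commutator_central:
  assumes J: "jordan_centralizer_map R \<phi>" and x: "x \<in> carrier R" and y: "y \<in> carrier R"
  shows "(y \<otimes> (x \<otimes> \<phi> \<one>)) \<oplus> (\<phi> \<one> \<otimes> (x \<otimes> y)) = (x \<otimes> (\<phi> \<one> \<otimes> y)) \<oplus> (y \<otimes> (\<phi> \<one> \<otimes> x))"
proof -
  have add: "additive_map R \<phi>"
    using J by (simp add: jordan_centralizer_map_def)
  define c where "c = \<phi> \<one>"
  have c: "c \<in> carrier R" and fy: "\<phi> y \<in> carrier R"
    using y by (auto simp: c_def additive_map_closed[OF add])
  let ?w = "(x \<otimes> y) \<oplus> (y \<otimes> x)"
  have "(?w \<otimes> c) \<oplus> (c \<otimes> ?w) = \<phi> ?w \<oplus> \<phi> ?w"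
    using jordan_centralizer_double[OF J, of ?w] x y by (simp add: c_def)
  also have "\<phi> ?w = (x \<otimes> \<phi> y) \<oplus> (\<phi> y \<otimes> x)"
    using J x y by (simp add: jordan_centralizer_map_def)
  \<comment> \<open>Distributivity collects the two copies of \<open>\<phi> y\<close>, so that only
    the double of \<open>\<phi> y\<close> occurs, and its value in terms of c is known.\<close>
  also have "\<dots> \<oplus> \<dots> = (x \<otimes> (\<phi> y \<oplus> \<phi> y)) \<oplus> ((\<phi> y \<oplus> \<phi> y) \<otimes> x)"
    using x fy by (simp add: l_distr r_distr a_ac)
  also have "\<phi> y \<oplus> \<phi> y = (y \<otimes> c) \<oplus> (c \<otimes> y)"
    using jordan_centralizer_double[OF J y] by (simp add: c_def)
  \<comment> \<open>The terms xyc and cyx occur on both sides; grouping them in front lets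
    cancellation leave yxc + cxy = xcy + ycx.\<close>
  finally have "((x \<otimes> (y \<otimes> c)) \<oplus> (c \<otimes> (y \<otimes> x))) \<oplus> ((y \<otimes> (x \<otimes> c)) \<oplus> (c \<otimes> (x \<otimes> y)))
      = ((x \<otimes> (y \<otimes> c)) \<oplus> (c \<otimes> (y \<otimes> x))) \<oplus> ((x \<otimes> (c \<otimes> y)) \<oplus> (y \<otimes> (c \<otimes> x)))"
    using x y c by (simp add: l_distr r_distr m_assoc a_ac)
  then show ?thesis
    using x y c unfolding c_def[symmetric] by simp
qed

text \<open>With c = \<open>\<phi> \<one>\<close> central, the doubled identity reads 2 \<phi>(x) =
  2 xc, and cancelling the 2 gives \<phi>(x) = xc. The rest is associativity and moving c past
  y.\<close>

lemma (in ring) jordan_centralizer_is_centralizer: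
  assumes J: "jordan_centralizer_map R \<phi>" and T: "two_torsion_free R"
    and central: "\<And>x. x \<in> carrier R \<Longrightarrow> \<phi> \<one> \<otimes> x = x \<otimes> \<phi> \<one>"
  shows "centralizer_map R \<phi>"
proof -
  have add: "additive_map R \<phi>"
    using J by (simp add: jordan_centralizer_map_def)
  have c: "\<phi> \<one> \<in> carrier R"
    by (simp add: additive_map_closed[OF add])
  have \<phi>: "\<phi> x = x \<otimes> \<phi> \<one>" if x: "x \<in> carrier R" for x
    using two_torsion_free_cancel[OF T additive_map_closed[OF add x], of "x \<otimes> \<phi> \<one>"]
      jordan_centralizer_double[OF J x] c x central by simp
  show ?thesis
    unfolding centralizer_map_def
  proof (intro conjI ballI add)
    fix x y assume xy: "x \<in> carrier R" "y \<in> carrier R"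
    show "\<phi> (x \<otimes> y) = x \<otimes> \<phi> y"
      using xy c by (simp add: \<phi>[of "x \<otimes> y"] \<phi>[of y] m_assoc)
    show "x \<otimes> \<phi> y = \<phi> x \<otimes> y"
      using xy c by (simp add: \<phi>[of x] \<phi>[of y] m_assoc central)
  qed
qed

section \<open>Bimodules: action of zero, and faithfulness as cancellation\<close>

context bimodule
begin

lemma smult_zero: "r \<in> carrier R \<Longrightarrow> r \<odot>\<^bsub>M\<^esub> \<zero>\<^bsub>M\<^esub> = \<zero>\<^bsub>M\<^esub>"
  using smult_r_distr[of r "\<zero>\<^bsub>M\<^esub>" "\<zero>\<^bsub>M\<^esub>"] smult_closed[of r "\<zero>\<^bsub>M\<^esub>"] by simp

lemma zero_rsmult: "s \<in> carrier S \<Longrightarrow> \<zero>\<^bsub>M\<^esub> \<triangleleft>\<^bsub>M\<^esub> s = \<zero>\<^bsub>M\<^esub>"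
  using rsmult_l_distr[of "\<zero>\<^bsub>M\<^esub>" "\<zero>\<^bsub>M\<^esub>" s] rsmult_closed[of "\<zero>\<^bsub>M\<^esub>" s] by simp

lemma zero_smult: "m \<in> carrier M \<Longrightarrow> \<zero>\<^bsub>R\<^esub> \<odot>\<^bsub>M\<^esub> m = \<zero>\<^bsub>M\<^esub>"
  using smult_l_distr[of "\<zero>\<^bsub>R\<^esub>" "\<zero>\<^bsub>R\<^esub>" m] smult_closed[of "\<zero>\<^bsub>R\<^esub>" m] by simp

lemma rsmult_zero: "m \<in> carrier M \<Longrightarrow> m \<triangleleft>\<^bsub>M\<^esub> \<zero>\<^bsub>S\<^esub> = \<zero>\<^bsub>M\<^esub>"
  using rsmult_r_distr[of m "\<zero>\<^bsub>S\<^esub>" "\<zero>\<^bsub>S\<^esub>"] rsmult_closed[of m "\<zero>\<^bsub>S\<^esub>"] by simp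

lemma faithful_left_cancel:
  assumes F: "faithful_left R M" and r: "r \<in> carrier R" "r' \<in> carrier R"
    and eq: "\<And>m. m \<in> carrier M \<Longrightarrow> r \<odot>\<^bsub>M\<^esub> m = r' \<odot>\<^bsub>M\<^esub> m"
  shows "r = r'"
proof -
  have "(r \<ominus>\<^bsub>R\<^esub> r') \<odot>\<^bsub>M\<^esub> m = \<zero>\<^bsub>M\<^esub>" if m: "m \<in> carrier M" for m
  proof -
    have "(r \<ominus>\<^bsub>R\<^esub> r') \<odot>\<^bsub>M\<^esub> m = (r \<odot>\<^bsub>M\<^esub> m) \<oplus>\<^bsub>M\<^esub> ((\<ominus>\<^bsub>R\<^esub> r') \<odot>\<^bsub>M\<^esub> m)"
      using r m by (simp add: R.minus_eq smult_l_distr)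
    \<comment> \<open>Replacing rm by r'm and recombining the scalars avoids any law for the action
      of a negated scalar.\<close>
    also have "\<dots> = (r' \<oplus>\<^bsub>R\<^esub> \<ominus>\<^bsub>R\<^esub> r') \<odot>\<^bsub>M\<^esub> m"
      using r m by (simp add: smult_l_distr eq del: R.r_neg)
    also have "\<dots> = \<zero>\<^bsub>M\<^esub>"
      using r m by (simp add: R.r_neg zero_smult)
    finally show ?thesis .
  qed
  then have "r \<ominus>\<^bsub>R\<^esub> r' = \<zero>\<^bsub>R\<^esub>"
    using F r by (simp add: faithful_left_def)
  then show ?thesis
    using r by (rule R.minus_zero_imp_eq[rotated 2])
qed

lemma faithful_right_cancel:
  assumes F: "faithful_right M S" and s: "s \<in> carrier S" "s' \<in> carrier S"
    and eq: "\<And>m. m \<in> carrier M \<Longrightarrow> m \<triangleleft>\<^bsub>M\<^esub> s = m \<triangleleft>\<^bsub>M\<^esub> s'"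
  shows "s = s'"
proof -
  have "m \<triangleleft>\<^bsub>M\<^esub> (s \<ominus>\<^bsub>S\<^esub> s') = \<zero>\<^bsub>M\<^esub>" if m: "m \<in> carrier M" for m
  proof -
    have "m \<triangleleft>\<^bsub>M\<^esub> (s \<ominus>\<^bsub>S\<^esub> s') = (m \<triangleleft>\<^bsub>M\<^esub> s) \<oplus>\<^bsub>M\<^esub> (m \<triangleleft>\<^bsub>M\<^esub> (\<ominus>\<^bsub>S\<^esub> s'))"
      using s m by (simp add: S.minus_eq rsmult_r_distr)
    also have "\<dots> = m \<triangleleft>\<^bsub>M\<^esub> (s' \<oplus>\<^bsub>S\<^esub> \<ominus>\<^bsub>S\<^esub> s')"
      using s m by (simp add: rsmult_r_distr eq del: S.r_neg)
    also have "\<dots> = \<zero>\<^bsub>M\<^esub>"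
      using s m by (simp add: S.r_neg rsmult_zero)
    finally show ?thesis .
  qed
  then have "s \<ominus>\<^bsub>S\<^esub> s' = \<zero>\<^bsub>S\<^esub>"
    using F s by (simp add: faithful_right_def)
  then show ?thesis
    using s by (rule S.minus_zero_imp_eq[rotated 2])
qed

section \<open>Torsion and central elements in the triangular ring\<close>

lemma Tri_two_torsion_free:
  assumes "two_torsion_free R" "two_torsion_free M" "two_torsion_free S"
  shows "two_torsion_free (Tri R M S)"
proof -
  interpret T: ring "Tri R M S"
    by (rule Tri_is_ring)
  have "x = \<zero>\<^bsub>Tri R M S\<^esub>"
    if x: "x \<in> carrier (Tri R M S)" and "add_pow (Tri R M S) (2::nat) x = \<zero>\<^bsub>Tri R M S\<^esub>" for x
  proof -
    obtain r m s where rms: "x = (r, m, s)" "r \<in> carrier R" "m \<in> carrier M" "s \<in> carrier S"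
      using x by (auto simp: Tri_def)
    have "x \<oplus>\<^bsub>Tri R M S\<^esub> x = \<zero>\<^bsub>Tri R M S\<^esub>"
      using that by (simp add: numeral_2_eq_2 T.add.nat_pow_Suc)
    then have "r \<oplus>\<^bsub>R\<^esub> r = \<zero>\<^bsub>R\<^esub>" "m \<oplus>\<^bsub>M\<^esub> m = \<zero>\<^bsub>M\<^esub>" "s \<oplus>\<^bsub>S\<^esub> s = \<zero>\<^bsub>S\<^esub>"
      by (auto simp: rms Tri_def)
    then have "r = \<zero>\<^bsub>R\<^esub>" "m = \<zero>\<^bsub>M\<^esub>" "s = \<zero>\<^bsub>S\<^esub>"
      using R.two_torsion_free_cancel[OF assms(1) rms(2) R.zero_closed]
        M.two_torsion_free_cancel[OF assms(2) rms(3) M.zero_closed]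
        S.two_torsion_free_cancel[OF assms(3) rms(4) S.zero_closed] by simp_all
    then show ?thesis
      by (simp add: rms Tri_def)
  qed
  then show ?thesis
    by (simp add: two_torsion_free_def)
qed

text \<open>By \<open>ab\<close>, the left action of a is the right action of b, which commutes with
  the left action of r: (ar)n = (rn)b = r(nb) = r(an) = (ra)n. Faithfulness then yields ar = ra. The
  upper right entries of the two products are am and mb, equal by \<open>ab\<close> again.\<close>

lemma Tri_diagonal_central:
  assumes FR: "faithful_left R M" and FS: "faithful_right M S"
    and a: "a \<in> carrier R" and b: "b \<in> carrier S"
    and ab: "\<And>n. n \<in> carrier M \<Longrightarrow> a \<odot>\<^bsub>M\<^esub> n = n \<triangleleft>\<^bsub>M\<^esub> b"
    and x: "x \<in> carrier (Tri R M S)"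
  shows "(a, \<zero>\<^bsub>M\<^esub>, b) \<otimes>\<^bsub>Tri R M S\<^esub> x = x \<otimes>\<^bsub>Tri R M S\<^esub> (a, \<zero>\<^bsub>M\<^esub>, b)"
proof -
  obtain r m s where rms: "x = (r, m, s)" "r \<in> carrier R" "m \<in> carrier M" "s \<in> carrier S"
    using x by (auto simp: Tri_def)
  have "a \<otimes>\<^bsub>R\<^esub> r = r \<otimes>\<^bsub>R\<^esub> a"
  proof (rule faithful_left_cancel[OF FR])
    fix n assume "n \<in> carrier M"
    then show "(a \<otimes>\<^bsub>R\<^esub> r) \<odot>\<^bsub>M\<^esub> n = (r \<otimes>\<^bsub>R\<^esub> a) \<odot>\<^bsub>M\<^esub> n"
      using a b rms by (simp add: smult_assoc ab smult_closed smult_rsmult_assoc)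
  qed (use a rms in auto)
  \<comment> \<open>Symmetrically, n(bs) = (an)s = a(ns) = (ns)b = n(sb).\<close>
  moreover have "b \<otimes>\<^bsub>S\<^esub> s = s \<otimes>\<^bsub>S\<^esub> b"
  proof (rule faithful_right_cancel[OF FS])
    fix n assume "n \<in> carrier M"
    then show "n \<triangleleft>\<^bsub>M\<^esub> (b \<otimes>\<^bsub>S\<^esub> s) = n \<triangleleft>\<^bsub>M\<^esub> (s \<otimes>\<^bsub>S\<^esub> b)"
      using a b rms
      by (simp add: rsmult_assoc ab[symmetric] rsmult_closed smult_rsmult_assoc)
  qed (use b rms in auto)
  ultimately show ?thesis
    using a b rms by (simp add: Tri_def smult_zero zero_rsmult ab rsmult_closed)
qed

text \<open>Hypothesis \<open>comm\<close> says that y commutes with [x, c]. Two choices of x, both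
  with y = e for the corner idempotent e, bring c into the form required by
  \<open>Tri_diagonal_central\<close>.\<close>

lemma Tri_central_if_commutators_central:
  assumes FR: "faithful_left R M" and FS: "faithful_right M S"
    and c: "c \<in> carrier (Tri R M S)"
    and comm: "\<And>x y. \<lbrakk>x \<in> carrier (Tri R M S); y \<in> carrier (Tri R M S)\<rbrakk> \<Longrightarrow>
      (y \<otimes>\<^bsub>Tri R M S\<^esub> (x \<otimes>\<^bsub>Tri R M S\<^esub> c)) \<oplus>\<^bsub>Tri R M S\<^esub> (c \<otimes>\<^bsub>Tri R M S\<^esub> (x \<otimes>\<^bsub>Tri R M S\<^esub> y)) =
      (x \<otimes>\<^bsub>Tri R M S\<^esub> (c \<otimes>\<^bsub>Tri R M S\<^esub> y)) \<oplus>\<^bsub>Tri R M S\<^esub> (y \<otimes>\<^bsub>Tri R M S\<^esub> (c \<otimes>\<^bsub>Tri R M S\<^esub> x))"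
    and x: "x \<in> carrier (Tri R M S)"
  shows "c \<otimes>\<^bsub>Tri R M S\<^esub> x = x \<otimes>\<^bsub>Tri R M S\<^esub> c"
proof -
  obtain a k b where akb: "c = (a, k, b)" "a \<in> carrier R" "k \<in> carrier M" "b \<in> carrier S"
    using c by (auto simp: Tri_def)
  note simps = Tri_def akb smult_zero zero_rsmult zero_smult rsmult_zero smult_one rsmult_one
    smult_closed rsmult_closed
  define e where "e = (\<one>\<^bsub>R\<^esub>, \<zero>\<^bsub>M\<^esub>, \<zero>\<^bsub>S\<^esub>)"
  have e: "e \<in> carrier (Tri R M S)"
    by (simp add: e_def Tri_def)
  \<comment> \<open>For x = y = e the two sides are (2a, k, 0) and (2a, 0, 0).\<close>
  have k: "k = \<zero>\<^bsub>M\<^esub>"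
    using comm[OF e e] by (simp add: e_def simps)
  \<comment> \<open>Here the products xy and x(cy) vanish, so the upper right entries are nb on the
    left and an on the right.\<close>
  have "a \<odot>\<^bsub>M\<^esub> n = n \<triangleleft>\<^bsub>M\<^esub> b" if n: "n \<in> carrier M" for n
    using comm[of "(\<zero>\<^bsub>R\<^esub>, n, \<zero>\<^bsub>S\<^esub>)" e] n e by (simp add: e_def simps)
  then show ?thesis
    using Tri_diagonal_central[OF FR FS akb(2,4) _ x] by (simp add: akb(1) k)
qed

end

theorem corollary3p2:
  fixes R :: "('a, 'd) ring_scheme"
    and M :: "('a, 'b, 'c, 'e) bimodule_scheme"
    and S :: "('c, 'f) ring_scheme"
    and \<phi> :: "'a \<times> 'b \<times> 'c \<Rightarrow> 'a \<times> 'b \<times> 'c"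
  assumes "ring R" and "ring S"
    and "two_torsion_free R" and "two_torsion_free S"
    and "bimodule R M S" and "two_torsion_free M"
    and "faithful_left R M" and "faithful_right M S"
    and "jordan_centralizer_map (Tri R M S) \<phi>"
  shows "centralizer_map (Tri R M S) \<phi>"
proof -
  interpret bimodule R M S by fact
  interpret T: ring "Tri R M S"
    by (rule Tri_is_ring)
  note J = \<open>jordan_centralizer_map (Tri R M S) \<phi>\<close>
  have c: "\<phi> \<one>\<^bsub>Tri R M S\<^esub> \<in> carrier (Tri R M S)"
    using J by (simp add: jordan_centralizer_map_def additive_map_closed)
  show ?thesis
  \<comment> \<open>Two obligations remain: torsion-freeness, checked entrywise, and centrality of
    \<open>\<phi> \<one>\<close>, which is where faithfulness enters.\<close>
  proof (rule T.jordan_centralizer_is_centralizer[OF J])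
    show "two_torsion_free (Tri R M S)"
      by (rule Tri_two_torsion_free) fact+
    show "\<phi> \<one>\<^bsub>Tri R M S\<^esub> \<otimes>\<^bsub>Tri R M S\<^esub> x = x \<otimes>\<^bsub>Tri R M S\<^esub> \<phi> \<one>\<^bsub>Tri R M S\<^esub>"
      if "x \<in> carrier (Tri R M S)" for x
      by (rule Tri_central_if_commutators_central[OF assms(7,8) c
            T.jordan_centralizer_commutator_central[OF J] that])
  qed
qed

end
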